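(* Let $A$ be a finite alphabet, let $X \in A^\omega$, and let $\mu$ be a positive Bernoulli measure over $A$. The following are equivalent. (i) $X$ is $\mu$-normal. (ii) Every probabilistic $\mu$-gambler $\mathcal{G}$ betting on $X$ loses almost surely, i.e. almost surely $\limsup_{n\to\infty}\mathrm{Capital}(\mathcal{G},X[0,n])<+\infty$.
   Context: Words and frequencies. $A^*$ is the set of finite words, $A^\omega$ the set of infinite sequences over $A$. Positions start at $0$; $X(i)$ is the $i$-th letter and $X[i,j]=X(i)X(i+1)\cdots X(j)$. For a word $u$ of length $k$ and a word $w$ of length $n\ge k$, $\mathrm{NbOcc}(u,w)=\#\{i : 0\le i\le n-k,\ w[i,i+k-1]=u\}$ and $\mathrm{Freq}(u,w)=\mathrm{NbOcc}(u,w)/(n-k+1)$. For $X\in A^\omega$, $\mathrm{Freq}(u,X)=\lim_{n\to\infty}\mathrm{Freq}(u,X[0,n])$ when this limit exists. Bernoulli measures. A positive Bernoulli measure is given by a function $\mu:A\to(0,1]$ with $\sum_{a\in A}\mu(a)=1$; for $w=a_0\cdots a_k$, $\mu(w)=\prod_{j=0}^k\mu(a_j)$. $X\in A^\omega$ is $\mu$-normal if $\mathrm{Freq}(w,X)$ exists and equals $\mu(w)$ for all $w\in A^*$. Probabilistic gamblers. A probabilistic $\mu$-gambler is a tuple $\mathcal{G}=(Q,A,q_I,\delta,\gamma)$ with $Q$ a finite set of states, $q_I\in Q$ the initial state, $\delta:Q\times A\to\Delta(Q)$ (where $\Delta(Q)$ is the set of probability distributions on $Q$), and $\gamma:Q\times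 A\to\mathbb{R}^{\ge 0}$ such that $\sum_{a\in A}\mu(a)\gamma(q,a)=1$ for every $q\in Q$. Its run on $X$ is the random sequence $q_0=q_I$, $q_{n+1}=\delta_{n+1}(q_n,X(n))$, where $\{\delta_n(r,b): n\in\mathbb{N}, r\in Q, b\in A\}$ is a family of independent $Q$-valued random variables, $\delta_n(r,b)$ having distribution $\delta(r,b)$. The capital is the random variable $\mathrm{Capital}(\mathcal{G},X[0,n])=\prod_{i=0}^{n}\gamma(q_i,X(i))$. $\mathcal{G}$ wins against $X$ if $\limsup_{n\to\infty}\mathrm{Capital}(\mathcal{G},X[0,n])=+\infty$; otherwise it loses. *)

theory Defs
  imports "HOL-Probability.Probability" "HOL-Library.Infinite_Typeclass"
begin

text \<open>The alphabet is the universe of a type of class \<open>finite\<close>; infinite sequences over it are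
  functions on \<open>nat\<close> and finite words are lists.\<close>

definition nb_occ :: "'a list \<Rightarrow> 'a list \<Rightarrow> nat" where
  "nb_occ u w = card {i. i + length u \<le> length w \<and> take (length u) (drop i w) = u}"

text \<open>Meant for \<open>length u \<le> length w\<close>; for longer \<open>u\<close> the value is \<open>0\<close>, which
  does not affect the limit below.\<close>

definition freq :: "'a list \<Rightarrow> 'a list \<Rightarrow> real" where
  "freq u w = real (nb_occ u w) / real (length w - length u + 1)"

text \<open>\<open>segment X n\<close> is $X[0,n]$, with both end points included.\<close>

definition segment :: "(nat \<Rightarrow> 'a) \<Rightarrow> nat \<Rightarrow> 'a list" where
  "segment X n = map X [0..<Suc n]"

definition positive_bernoulli :: "('a::finite \<Rightarrow> real) \<Rightarrow> bool" where
  "positive_bernoulli \<mu> \<longleftrightarrow> (\<forall>a. 0 < \<mu> a \<and> \<mu> a \<le> 1) \<and> (\<Sum>a\<in>UNIV. \<mu> a) = 1"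

definition word_measure :: "('a \<Rightarrow> real) \<Rightarrow> 'a list \<Rightarrow> real" where
  "word_measure \<mu> w = (\<Prod>j<length w. \<mu> (w ! j))"

definition normal_seq :: "('a \<Rightarrow> real) \<Rightarrow> (nat \<Rightarrow> 'a) \<Rightarrow> bool" where
  "normal_seq \<mu> X \<longleftrightarrow> (\<forall>w. (\<lambda>n. freq w (segment X n)) \<longlonglongrightarrow> word_measure \<mu> w)"

text \<open>The states of all gamblers under consideration lie in a common type \<open>'s\<close>, since a formula
  cannot quantify over types. If \<open>'s\<close> is infinite, every finite set of states has a copy in it.\<close>

record ('s, 'a) gambler =
  states :: "'s set"
  init :: 's
  step :: "'s \<Rightarrow> 'a \<Rightarrow> 's pmf"
  bet :: "'s \<Rightarrow> 'a \<Rightarrow> real"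

text \<open>A probability distribution on the set of states is a \<open>pmf\<close> supported in that set. The
  values of \<open>step\<close> and \<open>bet\<close> outside the set of states are irrelevant.\<close>

definition prob_gambler :: "('a::finite \<Rightarrow> real) \<Rightarrow> ('s, 'a) gambler \<Rightarrow> bool" where
  "prob_gambler \<mu> G \<longleftrightarrow>
     finite (states G) \<and> init G \<in> states G \<and>
     (\<forall>q\<in>states G. \<forall>a. set_pmf (step G q a) \<subseteq> states G) \<and>
     (\<forall>q\<in>states G. \<forall>a. 0 \<le> bet G q a) \<and>
     (\<forall>q\<in>states G. (\<Sum>a\<in>UNIV. \<mu> a * bet G q a) = 1)"

text \<open>The probability space carrying the independent family $\delta_n(r,b)$, realised canonically:
  on a point \<open>\<omega>\<close> of the product space, $\delta_n(r,b)$ takes the value \<open>\<omega> (n, r, b)\<close>.\<close>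

definition choice_space :: "('s, 'a) gambler \<Rightarrow> (nat \<times> 's \<times> 'a \<Rightarrow> 's) measure" where
  "choice_space G =
     (\<Pi>\<^sub>M (n, r, b) \<in> UNIV \<times> states G \<times> UNIV. measure_pmf (step G r b))"

lemma prob_space_choice_space: "prob_space (choice_space G)"
  unfolding choice_space_def by (rule prob_space_PiM) (auto simp: prob_space_measure_pmf)

primrec run :: "('s, 'a) gambler \<Rightarrow> (nat \<Rightarrow> 'a) \<Rightarrow> (nat \<times> 's \<times> 'a \<Rightarrow> 's) \<Rightarrow> nat \<Rightarrow> 's" where
  "run G X \<omega> 0 = init G"
| "run G X \<omega> (Suc n) = \<omega> (Suc n, run G X \<omega> n, X n)"

text \<open>\<open>capital G X \<omega> n\<close> is the capital after betting on all of $X[0,n]$.\<close>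

definition capital ::
  "('s, 'a) gambler \<Rightarrow> (nat \<Rightarrow> 'a) \<Rightarrow> (nat \<times> 's \<times> 'a \<Rightarrow> 's) \<Rightarrow> nat \<Rightarrow> real" where
  "capital G X \<omega> n = (\<Prod>i\<le>n. bet G (run G X \<omega> i) (X i))"

definition wins ::
  "('s, 'a) gambler \<Rightarrow> (nat \<Rightarrow> 'a) \<Rightarrow> (nat \<times> 's \<times> 'a \<Rightarrow> 's) \<Rightarrow> bool" where
  "wins G X \<omega> \<longleftrightarrow> limsup (\<lambda>n. ereal (capital G X \<omega> n)) = \<infinity>"

abbreviation loses ::
  "('s, 'a) gambler \<Rightarrow> (nat \<Rightarrow> 'a) \<Rightarrow> (nat \<times> 's \<times> 'a \<Rightarrow> 's) \<Rightarrow> bool" where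
  "loses G X \<omega> \<equiv> \<not> wins G X \<omega>"

end

theory Submission
  imports Defs
begin

text \<open>If \<open>v @ [a]\<close> is a shortest word with the wrong frequency, then the conditional
  frequency of \<open>a\<close> after \<open>v\<close> deviates from \<open>\<mu> a\<close> infinitely often by a fixed amount, and a gambler that
  remembers the last \<open>length v\<close> letters and bets a small fraction on or against \<open>a\<close> whenever it sees
  \<open>v\<close> gains exponentially along a subsequence.

  Conversely, let \<open>X\<close> be normal and call a state idle if only trivial bets can ever be placed from
  it. The expected square root of the capital, restricted to non-idle final states, of a word
  \<open>u @ v\<close> is at most its value for \<open>u\<close> times the sum over all initial states of its values for \<open>v\<close>.
  For independent \<open>\<mu>\<close>-distributed letters the mean of that sum tends to \<open>0\<close> with the length of \<open>v\<close>,
  so it is below \<open>1\<close> for some length \<open>L\<close>. Multiplying the block bounds for all \<open>L\<close> offsets gives a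
  product over all factors of length \<open>L\<close> of \<open>X\<close>; as \<open>x \<le> exp (x - 1)\<close>, normality makes it decay
  exponentially. By Markov's inequality and Borel-Cantelli almost every run reaches an idle state
  or has capital below \<open>1\<close> eventually.\<close>

section \<open>Frequencies as averages over starting positions\<close>

text \<open>Only the starting position has to lie below \<open>n\<close>; the occurrence may extend
  beyond it. This makes the count a plain sum over positions, without boundary terms.\<close>

definition factor_count :: "(nat \<Rightarrow> 'a) \<Rightarrow> 'a list \<Rightarrow> nat \<Rightarrow> real" where
  "factor_count X u n = (\<Sum>i<n. of_bool (map X [i..<i + length u] = u))"

text \<open>The segment has \<open>n + length u + 1\<close> letters, hence \<open>n + 2\<close>
  admissible starting positions, which is also the denominator in \<open>freq\<close>.\<close>

lemma freq_segment:
  "freq u (segment X (n + length u)) = factor_count X u (n + 2) / real (n + 2)"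
proof -
  have len: "length (segment X (n + length u)) = n + length u + 1"
    by (simp add: segment_def)
  have "{i. i + length u \<le> length (segment X (n + length u)) \<and>
      take (length u) (drop i (segment X (n + length u))) = u}
    = {i. i < n + 2 \<and> map X [i..<i + length u] = u}" (is "?L = ?R")
  proof -
    have "take (length u) (drop i (segment X (n + length u))) = map X [i..<i + length u]"
      if "i < n + 2" for i
      using that by (simp add: segment_def drop_map take_map del: upt_Suc)
    then show ?thesis by (auto simp: len)
  qed
  then have "real (nb_occ u (segment X (n + length u))) = factor_count X u (n + 2)"
    by (simp add: nb_occ_def factor_count_def lessThan_def flip: sum_of_bool_eq)
      (simp add: of_bool_def sum.If_cases Int_def conj_commute)
  then show ?thesis by (simp add: freq_def len)
qed

lemma freq_tendsto_iff:
  "(\<lambda>n. freq u (segment X n)) \<longlonglongrightarrow> l \<longleftrightarrow> (\<lambda>n. factor_count X u n / real n) \<longlonglongrightarrow> l"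
proof -
  have "(\<lambda>n. freq u (segment X n)) \<longlonglongrightarrow> l \<longleftrightarrow> (\<lambda>n. freq u (segment X (n + length u))) \<longlonglongrightarrow> l"
    using LIMSEQ_offset[of "\<lambda>n. freq u (segment X n)" "length u" l]
      LIMSEQ_ignore_initial_segment[of "\<lambda>n. freq u (segment X n)" l "length u"] by blast
  also have "\<dots> \<longleftrightarrow> (\<lambda>n. factor_count X u (n + 2) / real (n + 2)) \<longlonglongrightarrow> l"
    by (simp only: freq_segment)
  also have "\<dots> \<longleftrightarrow> (\<lambda>n. factor_count X u n / real n) \<longlonglongrightarrow> l"
    using LIMSEQ_offset[of "\<lambda>n. factor_count X u n / real n" 2 l]
      LIMSEQ_ignore_initial_segment[of "\<lambda>n. factor_count X u n / real n" l 2] by blast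
  finally show ?thesis .
qed

lemma normal_seq_iff:
  "normal_seq \<mu> X \<longleftrightarrow> (\<forall>u. (\<lambda>n. factor_count X u n / real n) \<longlonglongrightarrow> word_measure \<mu> u)"
  by (simp add: normal_seq_def freq_tendsto_iff)

lemma word_measure_Nil [simp]: "word_measure \<mu> [] = 1"
  by (simp add: word_measure_def)

lemma word_measure_Cons [simp]: "word_measure \<mu> (b # u) = \<mu> b * word_measure \<mu> u"
  by (simp only: word_measure_def length_Cons prod.lessThan_Suc_shift nth_Cons_0 nth_Cons_Suc)

lemma word_measure_append [simp]:
  "word_measure \<mu> (u @ v) = word_measure \<mu> u * word_measure \<mu> v"
  by (induction u) auto

text \<open>Only countably many times and finitely many states and letters occur, so the null sets
  can be united. On this event a gambler's run never leaves its states, and transitions that are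
  point masses become deterministic.\<close>

lemma AE_choices_supported:
  assumes "finite (states G)"
  shows "AE \<omega> in choice_space (G :: ('s, 'a::finite) gambler).
    \<forall>n. \<forall>r\<in>states G. \<forall>b. \<omega> (n, r, b) \<in> set_pmf (step G r b)"
proof -
  have "AE \<omega> in choice_space G. \<omega> (n, r, b) \<in> set_pmf (step G r b)"
    if "r \<in> states G" for n r b
    unfolding choice_space_def using that
    by (intro AE_PiM_component[where i = "(n, r, b)"])
      (auto simp: prob_space_measure_pmf AE_measure_pmf)
  then show ?thesis
    using assms by (auto simp: AE_all_countable intro!: AE_finite_allI)
qed

subsection \<open>Winning against sequences that are not normal\<close>

text \<open>States must live in \<open>'s\<close>, so the remembered suffix is stored through an
  injection \<open>enc\<close>. The sign of \<open>\<epsilon>\<close> decides whether the bet is on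
  or against \<open>a\<close>.\<close>

definition window_gambler ::
  "('a list \<Rightarrow> 's) \<Rightarrow> ('a \<Rightarrow> real) \<Rightarrow> 'a list \<Rightarrow> 'a \<Rightarrow> real \<Rightarrow> ('s, 'a) gambler" where
  "window_gambler enc \<mu> v a \<epsilon> =
    \<lparr>states = enc ` {u. length u \<le> length v},
     init = enc [],
     step = (\<lambda>s b. let u = inv enc s @ [b] in return_pmf (enc (drop (length u - length v) u))),
     bet = (\<lambda>s b. if inv enc s = v then 1 + \<epsilon> * (of_bool (b = a) - \<mu> a) else 1)\<rparr>"

text \<open>The bracket \<open>of_bool (b = a) - \<mu> a\<close> has mean 0 under
  \<open>\<mu>\<close> and absolute value at most 1, so the bets are fair and nonnegative.\<close>

lemma prob_gambler_window:
  fixes \<mu> :: "'a::finite \<Rightarrow> real"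
  assumes \<mu>: "positive_bernoulli \<mu>" and enc: "inj enc" and \<epsilon>: "\<bar>\<epsilon>\<bar> \<le> 1 / 2"
  shows "prob_gambler \<mu> (window_gambler enc \<mu> v a \<epsilon>)"
proof -
  have \<mu>1: "(\<Sum>a\<in>UNIV. \<mu> a) = 1" "0 < \<mu> a" "\<mu> a \<le> 1" for a
    using \<mu> by (auto simp: positive_bernoulli_def)
  have "finite {u :: 'a list. length u \<le> length v}"
    using finite_lists_length_le[of "UNIV :: 'a set"] by simp
  moreover have "0 \<le> 1 + \<epsilon> * (of_bool (b = a) - \<mu> a)" for b
  proof -
    have "\<bar>of_bool (b = a) - \<mu> a\<bar> \<le> 1" using \<mu>1(2,3)[of a] by auto
    then have "\<bar>\<epsilon> * (of_bool (b = a) - \<mu> a)\<bar> \<le> 1 / 2 * 1"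
      unfolding abs_mult using \<epsilon> by (intro mult_mono) auto
    then show ?thesis by linarith
  qed
  moreover have "(\<Sum>b\<in>UNIV. \<mu> b * (1 + \<epsilon> * (of_bool (b = a) - \<mu> a))) = 1"
  proof -
    have "(\<Sum>b\<in>UNIV. \<mu> b * (1 + \<epsilon> * (of_bool (b = a) - \<mu> a)))
      = (\<Sum>b\<in>UNIV. \<mu> b) * (1 - \<epsilon> * \<mu> a) + \<epsilon> * (\<Sum>b\<in>UNIV. \<mu> b * of_bool (b = a))"
      unfolding sum_distrib_left sum_distrib_right sum.distrib[symmetric]
      by (intro sum.cong) (auto simp: algebra_simps)
    also have "(\<Sum>b\<in>UNIV. \<mu> b * of_bool (b = a)) = \<mu> a"
      by (simp add: of_bool_def if_distrib cong: if_cong)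
    finally show ?thesis by (simp add: \<mu>1)
  qed
  then have "(\<Sum>b\<in>UNIV. \<mu> b * (if q = v then 1 + \<epsilon> * (of_bool (b = a) - \<mu> a) else 1)) = 1" for q
    by (cases "q = v") (simp_all only: if_True if_False mult_1_right \<mu>1 refl)
  ultimately show ?thesis
    using enc by (auto simp: prob_gambler_def window_gambler_def Let_def)
qed

text \<open>All transitions are point masses, so choices in the supports leave one possible run.
  Truncated subtraction covers the first steps, where fewer than \<open>length v\<close> letters
  have been read.\<close>

lemma run_window:
  fixes X :: "nat \<Rightarrow> 'a::finite" and enc :: "'a list \<Rightarrow> 's" and \<mu> :: "'a \<Rightarrow> real"
    and v :: "'a list" and a :: 'a and \<epsilon> :: real
  defines "G \<equiv> window_gambler enc \<mu> v a \<epsilon>"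
  assumes enc: "inj enc"
    and \<omega>: "\<forall>n. \<forall>r\<in>states G. \<forall>b. \<omega> (n, r, b) \<in> set_pmf (step G r b)"
  shows "run G X \<omega> n = enc (map X [n - length v..<n])"
proof (induction n)
  case 0
  then show ?case by (simp add: G_def window_gambler_def)
next
  case (Suc n)
  let ?s = "map X [n - length v..<n]"
  have "step G (enc ?s) (X n)
    = return_pmf (enc (drop (length (?s @ [X n]) - length v) (?s @ [X n])))"
    by (simp add: G_def window_gambler_def Let_def inv_f_f[OF enc] del: drop_append)
  also have "?s @ [X n] = map X [n - length v..<Suc n]" by simp
  also have "drop (length \<dots> - length v) \<dots> = map X [Suc n - length v..<Suc n]"
  proof -
    have "n - length v + (Suc n - (n - length v) - length v) = Suc n - length v" by auto
    then show ?thesis by (simp only: drop_map drop_upt length_map length_upt)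
  qed
  finally have "step G (enc ?s) (X n) = return_pmf (enc (map X [Suc n - length v..<Suc n]))" .
  moreover have "enc ?s \<in> states G" by (auto simp: G_def window_gambler_def)
  then have "\<omega> (Suc n, enc ?s, X n) \<in> set_pmf (step G (enc ?s) (X n))" using \<omega> by blast
  ultimately show ?case by (simp add: Suc del: upt_Suc)
qed

text \<open>The first \<open>length v\<close> bets are trivial because the remembered word is still
  too short. The bet at time \<open>length v + i\<close> depends on whether \<open>v\<close> starts
  at \<open>i\<close> and is followed by \<open>a\<close>.\<close>

lemma capital_window:
  fixes X :: "nat \<Rightarrow> 'a::finite" and enc :: "'a list \<Rightarrow> 's" and \<mu> :: "'a \<Rightarrow> real"
    and v :: "'a list" and a :: 'a and \<epsilon> :: real
  defines "G \<equiv> window_gambler enc \<mu> v a \<epsilon>"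
  assumes enc: "inj enc"
    and \<omega>: "\<forall>n. \<forall>r\<in>states G. \<forall>b. \<omega> (n, r, b) \<in> set_pmf (step G r b)"
  shows "capital G X \<omega> (length v + n) = (\<Prod>i<Suc n. 1 + \<epsilon> *
    (of_bool (map X [i..<i + length (v @ [a])] = v @ [a])
      - \<mu> a * of_bool (map X [i..<i + length v] = v)))"
proof -
  let ?k = "length v"
  let ?f = "\<lambda>i. bet G (run G X \<omega> i) (X i)"
  have r: "run G X \<omega> i = enc (map X [i - ?k..<i])" for i
    unfolding G_def by (rule run_window[OF enc \<omega>[unfolded G_def]])
  have "?f i = 1" if "i < ?k" for i
  proof -
    have "map X [i - ?k..<i] \<noteq> v" using that by auto
    then show ?thesis by (simp add: r) (simp add: G_def window_gambler_def inv_f_f[OF enc])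
  qed
  then have 1: "(\<Prod>i<?k. ?f i) = 1" by simp
  have 2: "?f (?k + i) = 1 + \<epsilon> * (of_bool (map X [i..<i + length (v @ [a])] = v @ [a])
      - \<mu> a * of_bool (map X [i..<i + ?k] = v))" for i
    by (simp add: r) (auto simp: G_def window_gambler_def inv_f_f[OF enc] add.commute)
  have "(\<Prod>i<?k + m. f i) = (\<Prod>i<?k. f i) * (\<Prod>i<m. f (?k + i))" for f :: "nat \<Rightarrow> real" and m
    by (induction m) (simp_all add: mult.assoc)
  from this[of ?f "Suc n"] show ?thesis
    unfolding capital_def 1 2 by (simp only: add_Suc_right lessThan_Suc_atMost mult_1)
qed

text \<open>A second-order lower bound on the logarithm, which turns the product of bets into the
  exponential of a sum.\<close>

lemma exp_le_one_plus:
  fixes x :: real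
  assumes "\<bar>x\<bar> \<le> 1 / 2"
  shows "exp (x - 2 * x\<^sup>2) \<le> 1 + x"
proof -
  have "x - 2 * x\<^sup>2 \<le> ln (1 + x)"
    using abs_ln_one_plus_x_minus_x_bound[OF assms] by (simp add: abs_if split: if_splits)
  then have "exp (x - 2 * x\<^sup>2) \<le> exp (ln (1 + x))" by simp
  with assms show ?thesis by simp
qed

lemma wins_if_frequently_exp:
  assumes "0 < c" and "\<exists>\<^sub>F n in sequentially. exp (c * real (Suc n)) \<le> capital G X \<omega> (k + n)"
  shows "wins G X \<omega>"
proof (rule ccontr)
  assume "\<not> wins G X \<omega>"
  then obtain y where "limsup (\<lambda>n. ereal (capital G X \<omega> n)) < ereal y"
    by (auto simp: wins_def less_PInf_Ex_of_nat)
  then have "\<forall>\<^sub>F n in sequentially. capital G X \<omega> n < y" using Limsup_lessD by fastforce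
  then have "\<forall>\<^sub>F n in sequentially. capital G X \<omega> (n + k) < y"
    by (rule sequentially_offset)
  moreover have "\<forall>\<^sub>F n in sequentially. y < exp (c * real (Suc n))"
  proof -
    obtain N where "y / c < real N" using reals_Archimedean2 by blast
    then have "y < c * real N" using assms(1) by (simp add: field_simps)
    then have "y < exp (c * real (Suc n))" if "n \<ge> N" for n
    proof -
      have "c * real N \<le> c * real (Suc n)" using assms(1) that by simp
      then show ?thesis using \<open>y < c * real N\<close> exp_ge_add_one_self[of "c * real (Suc n)"] by linarith
    qed
    then show ?thesis by (auto simp: eventually_sequentially)
  qed
  ultimately have "\<forall>\<^sub>F n in sequentially. \<not> exp (c * real (Suc n)) \<le> capital G X \<omega> (k + n)"
    by eventually_elim (simp add: add.commute)
  with assms(2) show False by (simp add: frequently_def)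
qed

text \<open>The linear terms contribute at least \<open>\<bar>\<epsilon>\<bar> * \<delta>\<close>
  per step infinitely often, while the quadratic loss \<open>2 * \<epsilon>\<^sup>2\<close> is at
  most half of that because \<open>4 * \<bar>\<epsilon>\<bar> \<le> \<delta>\<close>.\<close>

lemma wins_window:
  fixes X :: "nat \<Rightarrow> 'a::finite" and enc :: "'a list \<Rightarrow> 's" and \<mu> :: "'a \<Rightarrow> real"
    and v :: "'a list" and a :: 'a and \<epsilon> \<delta> :: real
  defines "G \<equiv> window_gambler enc \<mu> v a \<epsilon>"
  assumes \<mu>: "positive_bernoulli \<mu>" and enc: "inj enc"
    and \<omega>: "\<forall>n. \<forall>r\<in>states G. \<forall>b. \<omega> (n, r, b) \<in> set_pmf (step G r b)"
    and \<epsilon>: "0 < \<bar>\<epsilon>\<bar>" "\<bar>\<epsilon>\<bar> \<le> 1 / 2" "4 * \<bar>\<epsilon>\<bar> \<le> \<delta>"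
    and dev: "\<exists>\<^sub>F n in sequentially.
      \<delta> * real (Suc n) \<le> sgn \<epsilon> * (factor_count X (v @ [a]) (Suc n) - \<mu> a * factor_count X v (Suc n))"
  shows "wins G X \<omega>"
proof (rule wins_if_frequently_exp)
  have \<mu>a: "0 < \<mu> a" "\<mu> a \<le> 1" using \<mu> by (auto simp: positive_bernoulli_def)
  show "0 < \<bar>\<epsilon>\<bar> * \<delta> / 2" using \<epsilon> by simp
  define x where "x i = \<epsilon> * (of_bool (map X [i..<i + length (v @ [a])] = v @ [a])
      - \<mu> a * of_bool (map X [i..<i + length v] = v))" for i
  have x: "\<bar>x i\<bar> \<le> \<bar>\<epsilon>\<bar>" for i
  proof -
    have "\<bar>of_bool (map X [i..<i + length (v @ [a])] = v @ [a])
      - \<mu> a * of_bool (map X [i..<i + length v] = v)\<bar> \<le> 1" using \<mu>a by auto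
    then show ?thesis by (simp add: x_def abs_mult mult_left_le)
  qed
  have cap: "exp ((\<Sum>i<Suc n. x i) - 2 * \<epsilon>\<^sup>2 * real (Suc n)) \<le> capital G X \<omega> (length v + n)" for n
  proof -
    have "(\<Sum>i<Suc n. x i) - 2 * \<epsilon>\<^sup>2 * real (Suc n) = (\<Sum>i<Suc n. x i - 2 * \<epsilon>\<^sup>2)"
      by (simp add: sum_subtractf algebra_simps)
    then have "exp ((\<Sum>i<Suc n. x i) - 2 * \<epsilon>\<^sup>2 * real (Suc n)) = (\<Prod>i<Suc n. exp (x i - 2 * \<epsilon>\<^sup>2))"
      by (simp add: exp_sum del: sum.lessThan_Suc prod.lessThan_Suc)
    also have "\<dots> \<le> (\<Prod>i<Suc n. 1 + x i)"
    proof (intro prod_mono conjI)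
      fix i
      have "(x i)\<^sup>2 \<le> \<epsilon>\<^sup>2" using x[of i] abs_le_square_iff by blast
      then have "exp (x i - 2 * \<epsilon>\<^sup>2) \<le> exp (x i - 2 * (x i)\<^sup>2)" by simp
      also have "\<dots> \<le> 1 + x i" using x[of i] \<epsilon> by (intro exp_le_one_plus) simp
      finally show "exp (x i - 2 * \<epsilon>\<^sup>2) \<le> 1 + x i" .
    qed simp
    also have "\<dots> = capital G X \<omega> (length v + n)"
      unfolding G_def x_def by (rule capital_window[OF enc \<omega>[unfolded G_def], symmetric])
    finally show ?thesis .
  qed
  show "\<exists>\<^sub>F n in sequentially. exp (\<bar>\<epsilon>\<bar> * \<delta> / 2 * real (Suc n)) \<le> capital G X \<omega> (length v + n)"
    using dev
  proof (rule frequently_elim1)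
    fix n
    assume *: "\<delta> * real (Suc n)
      \<le> sgn \<epsilon> * (factor_count X (v @ [a]) (Suc n) - \<mu> a * factor_count X v (Suc n))"
    have "(\<Sum>i<Suc n. x i) = \<epsilon> * (factor_count X (v @ [a]) (Suc n) - \<mu> a * factor_count X v (Suc n))"
      unfolding x_def factor_count_def sum_distrib_left sum_subtractf[symmetric] by simp
    also have "\<dots> = \<bar>\<epsilon>\<bar> * (sgn \<epsilon> * (factor_count X (v @ [a]) (Suc n) - \<mu> a * factor_count X v (Suc n)))"
      by (metis abs_mult_sgn mult.assoc)
    also have "\<dots> \<ge> \<bar>\<epsilon>\<bar> * (\<delta> * real (Suc n))"
      using * by (intro mult_left_mono) auto
    finally have "\<bar>\<epsilon>\<bar> * \<delta> * real (Suc n) \<le> (\<Sum>i<Suc n. x i)" by simp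
    moreover have "2 * \<epsilon>\<^sup>2 * real (Suc n) \<le> \<bar>\<epsilon>\<bar> * \<delta> / 2 * real (Suc n)"
    proof (rule mult_right_mono)
      have "\<bar>\<epsilon>\<bar> * (4 * \<bar>\<epsilon>\<bar>) \<le> \<bar>\<epsilon>\<bar> * \<delta>" using \<epsilon> by (intro mult_left_mono) auto
      moreover have "\<bar>\<epsilon>\<bar> * \<bar>\<epsilon>\<bar> = \<epsilon>\<^sup>2" by (simp add: power2_eq_square)
      ultimately show "2 * \<epsilon>\<^sup>2 \<le> \<bar>\<epsilon>\<bar> * \<delta> / 2" by linarith
    qed simp
    ultimately have "\<bar>\<epsilon>\<bar> * \<delta> / 2 * real (Suc n) \<le> (\<Sum>i<Suc n. x i) - 2 * \<epsilon>\<^sup>2 * real (Suc n)"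
      by argo
    then show "exp (\<bar>\<epsilon>\<bar> * \<delta> / 2 * real (Suc n)) \<le> capital G X \<omega> (length v + n)"
      using cap[of n] by (meson exp_le_cancel_iff order_trans)
  qed
qed

lemma normal_seq_if_gamblers_lose:
  fixes \<mu> :: "'a::finite \<Rightarrow> real" and X :: "nat \<Rightarrow> 'a"
  assumes \<mu>: "positive_bernoulli \<mu>"
    and lose: "\<And>G :: ('s::infinite, 'a) gambler. prob_gambler \<mu> G \<Longrightarrow>
      AE \<omega> in choice_space G. loses G X \<omega>"
  shows "normal_seq \<mu> X"
  unfolding normal_seq_iff
proof
  \<comment> \<open>An infinite type contains a copy of \<open>nat\<close>, hence of the countable
    set of words; this provides the state codes.\<close>
  obtain e :: "nat \<Rightarrow> 's" where "inj e"
    using infinite_countable_subset[OF infinite_UNIV] by blast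
  then have enc: "inj (e \<circ> to_nat :: 'a list \<Rightarrow> 's)" by (auto intro: inj_compose)
  fix w
  show "(\<lambda>n. factor_count X w n / real n) \<longlonglongrightarrow> word_measure \<mu> w"
  proof (induction w rule: rev_induct)
    case Nil
    have "\<forall>\<^sub>F n in sequentially. factor_count X [] n / real n = 1"
      using eventually_gt_at_top[of 0] by eventually_elim (simp add: factor_count_def)
    then show ?case by (simp add: tendsto_eventually)
  next
    case (snoc a v)
    define d where "d n = factor_count X (v @ [a]) n - \<mu> a * factor_count X v n" for n
    have "(\<lambda>n. d n / real n) \<longlonglongrightarrow> 0"
    proof (rule ccontr)
      assume "\<not> (\<lambda>n. d n / real n) \<longlonglongrightarrow> 0"
      then have "\<not> (\<lambda>n. d (Suc n) / real (Suc n)) \<longlonglongrightarrow> 0"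
        using filterlim_sequentially_Suc[of "\<lambda>n. d n / real n"] by blast
      then obtain \<delta> where \<delta>: "\<delta> > 0"
        "\<not> (\<forall>\<^sub>F n in sequentially. dist (d (Suc n) / real (Suc n)) 0 < \<delta>)"
        by (auto simp: tendsto_iff)
      \<comment> \<open>The deviation is large infinitely often in absolute value, so one of the two
        signs occurs infinitely often.\<close>
      have "\<exists>\<^sub>F n in sequentially.
        \<delta> * real (Suc n) \<le> 1 * d (Suc n) \<or> \<delta> * real (Suc n) \<le> (-1) * d (Suc n)"
        using \<delta>(2) unfolding not_eventually
        by (rule frequently_elim1)
          (auto simp: not_less abs_if field_simps split: if_splits simp del: of_nat_Suc)
      then obtain s :: real where s: "s = 1 \<or> s = -1"
        "\<exists>\<^sub>F n in sequentially. \<delta> * real (Suc n) \<le> s * d (Suc n)"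
        unfolding frequently_disj_iff by blast
      \<comment> \<open>The two terms of the minimum are the two upper bounds on
        \<open>\<bar>\<epsilon>\<bar>\<close> that \<open>wins_window\<close> requires.\<close>
      define \<epsilon> where "\<epsilon> = s * min (1 / 2) (\<delta> / 4)"
      have "min (1 / 2) (\<delta> / 4) > 0" using \<delta> by simp
      then have \<epsilon>: "\<bar>\<epsilon>\<bar> = min (1 / 2) (\<delta> / 4)" "sgn \<epsilon> = s"
        using s(1) by (auto simp: \<epsilon>_def sgn_mult)
      let ?G = "window_gambler (e \<circ> to_nat) \<mu> v a \<epsilon> :: ('s, 'a) gambler"
      interpret prob_space "choice_space ?G" by (rule prob_space_choice_space)
      have G: "prob_gambler \<mu> ?G" using \<mu> enc \<epsilon> by (intro prob_gambler_window) auto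
      have "AE \<omega> in choice_space ?G. wins ?G X \<omega>"
      proof -
        have "finite (states ?G)" using G by (simp add: prob_gambler_def)
        from AE_choices_supported[OF this] show ?thesis
        proof eventually_elim
          case (elim \<omega>)
          then show ?case
            using \<mu> enc \<epsilon> \<delta>(1) s(2) by (intro wins_window[where \<delta> = \<delta>]) (auto simp: d_def)
        qed
      qed
      with lose[OF G] have "AE \<omega> in choice_space ?G. False" by eventually_elim simp
      then show False by simp
    qed
    then have "(\<lambda>n. d n / real n + \<mu> a * (factor_count X v n / real n)) \<longlonglongrightarrow> 0 + \<mu> a * word_measure \<mu> v"
      by (intro tendsto_intros snoc)
    moreover have "d n / real n + \<mu> a * (factor_count X v n / real n) = factor_count X (v @ [a]) n / real n" for n
      by (simp add: d_def diff_divide_distrib)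
    ultimately show ?case by (simp add: mult.commute)
  qed
qed

subsection \<open>Losing against normal sequences\<close>

lemma finite_words_length [simp]: "finite {u :: 'a::finite list. length u = n}"
  using finite_lists_length_eq[of "UNIV :: 'a set" n] by simp

lemma sum_words_Suc:
  fixes f :: "'a::finite list \<Rightarrow> real"
  shows "(\<Sum>u | length u = Suc n. f u) = (\<Sum>b\<in>UNIV. \<Sum>u | length u = n. f (b # u))"
proof -
  have "{u :: 'a list. length u = Suc n} = (\<lambda>(b, u). b # u) ` (UNIV \<times> {u. length u = n})"
    by (auto simp: length_Suc_conv image_iff)
  then show ?thesis
    by (simp add: sum.reindex inj_on_def sum.cartesian_product case_prod_unfold)
qed

locale losing_gambler =
  fixes \<mu> :: "'a::finite \<Rightarrow> real" and G :: "('s, 'a) gambler"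
  assumes bernoulli: "positive_bernoulli \<mu>" and gambler: "prob_gambler \<mu> G"
begin

lemma mu_pos: "0 < \<mu> a" and mu_sum: "(\<Sum>a\<in>UNIV. \<mu> a) = 1"
  using bernoulli by (auto simp: positive_bernoulli_def)

lemma
  shows finite_states: "finite (states G)"
    and init_state: "init G \<in> states G"
    and step_state: "q \<in> states G \<Longrightarrow> set_pmf (step G q a) \<subseteq> states G"
    and bet_nonneg: "q \<in> states G \<Longrightarrow> 0 \<le> bet G q a"
    and bet_fair: "q \<in> states G \<Longrightarrow> (\<Sum>a\<in>UNIV. \<mu> a * bet G q a) = 1"
  using gambler by (auto simp: prob_gambler_def)

lemma sum_pmf_step: "q \<in> states G \<Longrightarrow> (\<Sum>q'\<in>states G. pmf (step G q a) q') = 1"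
  using finite_states step_state by (rule sum_pmf_eq_1)

lemma word_measure_nonneg: "0 \<le> word_measure \<mu> u"
  by (auto simp: word_measure_def intro!: prod_nonneg less_imp_le[OF mu_pos])

lemma weight_nonneg: "q \<in> states G \<Longrightarrow> 0 \<le> \<mu> b * sqrt (bet G q b)"
  using less_imp_le[OF mu_pos] bet_nonneg by simp

text \<open>By fairness, \<open>2 - 2 * ?s\<close> is the \<open>\<mu>\<close>-mean of the squares
  of \<open>sqrt (bet G q b) - 1\<close>. It is nonnegative, and when it vanishes every square does,
  since \<open>\<mu>\<close> is positive.\<close>

lemma sum_sqrt_bet:
  assumes "q \<in> states G"
  shows "(\<Sum>b\<in>UNIV. \<mu> b * sqrt (bet G q b)) \<le> 1"
    and "1 \<le> (\<Sum>b\<in>UNIV. \<mu> b * sqrt (bet G q b)) \<Longrightarrow> bet G q b = 1"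
proof -
  let ?s = "\<Sum>b\<in>UNIV. \<mu> b * sqrt (bet G q b)"
  have "(\<Sum>b\<in>UNIV. \<mu> b * (sqrt (bet G q b) - 1)\<^sup>2)
    = (\<Sum>b\<in>UNIV. \<mu> b * bet G q b) - 2 * ?s + (\<Sum>b\<in>UNIV. \<mu> b)"
    unfolding sum_distrib_left sum.distrib[symmetric] sum_subtractf[symmetric]
    by (intro sum.cong) (auto simp: power2_diff bet_nonneg[OF assms] algebra_simps)
  then have *: "(\<Sum>b\<in>UNIV. \<mu> b * (sqrt (bet G q b) - 1)\<^sup>2) = 2 - 2 * ?s"
    by (simp add: bet_fair[OF assms] mu_sum)
  have nonneg: "0 \<le> \<mu> b * (sqrt (bet G q b) - 1)\<^sup>2" for b
    using mu_pos[of b] by simp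
  then have "0 \<le> (\<Sum>b\<in>UNIV. \<mu> b * (sqrt (bet G q b) - 1)\<^sup>2)" by (intro sum_nonneg)
  with * show "?s \<le> 1" by linarith
  assume "1 \<le> ?s"
  with * have "(\<Sum>b\<in>UNIV. \<mu> b * (sqrt (bet G q b) - 1)\<^sup>2) \<le> 0" by linarith
  then have "(\<Sum>b\<in>UNIV. \<mu> b * (sqrt (bet G q b) - 1)\<^sup>2) = 0"
    using nonneg by (intro antisym sum_nonneg) auto
  then have "\<mu> b * (sqrt (bet G q b) - 1)\<^sup>2 = 0"
    using nonneg by (simp add: sum_nonneg_eq_0_iff)
  then show "bet G q b = 1" using mu_pos[of b] by simp
qed

text \<open>Closed sets of states with trivial bets are stable under union, so this is the largest
  one. Once it is entered, the capital is constant.\<close>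

definition idle :: "'s set" where
  "idle = \<Union> {S. S \<subseteq> states G \<and> (\<forall>q\<in>S. \<forall>b. bet G q b = 1 \<and> set_pmf (step G q b) \<subseteq> S)}"

lemma idle_bet: "q \<in> idle \<Longrightarrow> bet G q b = 1"
  and idle_step: "q \<in> idle \<Longrightarrow> set_pmf (step G q b) \<subseteq> idle"
  unfolding idle_def by blast+

text \<open>\<open>val q u\<close> is the expected square root of the capital gained from state \<open>q\<close> on
  the word \<open>u\<close>, restricted to the event that the final state is not idle.\<close>

primrec val :: "'s \<Rightarrow> 'a list \<Rightarrow> real" where
  "val q [] = of_bool (q \<notin> idle)"
| "val q (b # u) = sqrt (bet G q b) * (\<Sum>q'\<in>states G. pmf (step G q b) q' * val q' u)"

text \<open>Summing over all initial states gives a bound that depends on the word alone and not on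
  the state in which the gambler meets it.\<close>

definition tot :: "'a list \<Rightarrow> real" where
  "tot u = (\<Sum>q\<in>states G. val q u)"

lemma val_nonneg: "q \<in> states G \<Longrightarrow> 0 \<le> val q u"
  by (induction u arbitrary: q) (auto intro!: mult_nonneg_nonneg sum_nonneg bet_nonneg)

lemma tot_nonneg: "0 \<le> tot u"
  by (auto simp: tot_def intro: sum_nonneg val_nonneg)

lemma val_le_tot: "q \<in> states G \<Longrightarrow> val q u \<le> tot u"
  unfolding tot_def by (rule member_le_sum) (auto intro: val_nonneg finite_states)

lemma val_idle: "q \<in> idle \<Longrightarrow> val q u = 0"
proof (induction u arbitrary: q)
  case (Cons b u)
  have "pmf (step G q b) q' * val q' u = 0" for q'
    using idle_step[OF Cons.prems] Cons.IH by (cases "q' \<in> idle") (auto simp: pmf_eq_0_set_pmf)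
  then have "(\<Sum>q'\<in>states G. pmf (step G q b) q' * val q' u) = 0" by (rule sum.neutral[OF ballI])
  then show ?case by simp
qed simp

text \<open>Runs that are idle after \<open>u\<close> remain idle and contribute nothing, so
  restricting to non-idle states after \<open>u\<close> loses nothing; from each remaining state the
  value of \<open>v\<close> is at most \<open>tot v\<close>.\<close>

lemma val_append: "q \<in> states G \<Longrightarrow> val q (u @ v) \<le> val q u * tot v"
proof (induction u arbitrary: q)
  case Nil
  then show ?case by (cases "q \<in> idle") (auto simp: val_idle val_le_tot)
next
  case (Cons b u)
  have "val q ((b # u) @ v)
    \<le> sqrt (bet G q b) * (\<Sum>q'\<in>states G. pmf (step G q b) q' * (val q' u * tot v))"
    using Cons by (auto intro!: mult_left_mono sum_mono bet_nonneg)
  also have "\<dots> = val q (b # u) * tot v"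
    by (simp add: sum_distrib_left sum_distrib_right mult_ac)
  finally show ?case .
qed

section \<open>Mean of \<open>val\<close> over random words\<close>

text \<open>Defined by iterating an averaging operator, which gives monotonicity and a fixed-point
  equation for the limit; \<open>avg_eq\<close> identifies it with the mean of \<open>val\<close>
  over \<open>\<mu>\<close>-random words.\<close>

primrec avg :: "nat \<Rightarrow> 's \<Rightarrow> real" where
  "avg 0 q = of_bool (q \<notin> idle)"
| "avg (Suc n) q = (\<Sum>b\<in>UNIV. \<mu> b * sqrt (bet G q b) *
     (\<Sum>q'\<in>states G. pmf (step G q b) q' * avg n q'))"

lemma avg_eq: "avg n q = (\<Sum>u | length u = n. word_measure \<mu> u * val q u)"
proof (induction n arbitrary: q)
  case (Suc n)
  have "(\<Sum>u | length u = n. word_measure \<mu> (b # u) * val q (b # u))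
    = \<mu> b * sqrt (bet G q b) * (\<Sum>q'\<in>states G. pmf (step G q b) q' * avg n q')" for b
    unfolding Suc sum_distrib_left
    by (subst sum.swap) (simp add: sum_distrib_left mult_ac)
  then show ?case by (simp only: avg.simps sum_words_Suc)
qed simp

lemma avg_nonneg: "q \<in> states G \<Longrightarrow> 0 \<le> avg n q"
  by (auto simp: avg_eq intro!: sum_nonneg mult_nonneg_nonneg word_measure_nonneg val_nonneg)

lemma avg_idle: "q \<in> idle \<Longrightarrow> avg n q = 0"
  by (simp add: avg_eq val_idle)

text \<open>The operator is monotone, and by \<open>sum_sqrt_bet\<close> one application does not
  raise the indicator of the non-idle states.\<close>

lemma avg_Suc_le: "q \<in> states G \<Longrightarrow> avg (Suc n) q \<le> avg n q"
proof (induction n arbitrary: q)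
  case 0
  show ?case
  proof (cases "q \<in> idle")
    case True
    then show ?thesis by (simp add: avg_idle del: avg.simps(2))
  next
    case False
    have "avg (Suc 0) q \<le> (\<Sum>b\<in>UNIV. \<mu> b * sqrt (bet G q b) * 1)"
      unfolding avg.simps
    proof (intro sum_mono mult_left_mono)
      fix b
      have "(\<Sum>q'\<in>states G. pmf (step G q b) q' * of_bool (q' \<notin> idle))
        \<le> (\<Sum>q'\<in>states G. pmf (step G q b) q')"
        by (intro sum_mono) (auto simp: mult_left_le)
      then show "(\<Sum>q'\<in>states G. pmf (step G q b) q' * of_bool (q' \<notin> idle)) \<le> 1"
        by (simp add: sum_pmf_step 0)
    qed (rule weight_nonneg[OF 0])
    also have "\<dots> \<le> 1" using sum_sqrt_bet(1)[OF 0] by simp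
    finally show ?thesis using False by simp
  qed
next
  case (Suc n)
  have "avg (Suc (Suc n)) q = (\<Sum>b\<in>UNIV. \<mu> b * sqrt (bet G q b) *
     (\<Sum>q'\<in>states G. pmf (step G q b) q' * avg (Suc n) q'))"
    by (rule avg.simps)
  also have "\<dots> \<le> avg (Suc n) q"
    unfolding avg.simps(2)[of n q]
    by (intro sum_mono mult_left_mono weight_nonneg Suc) auto
  finally show ?case .
qed

text \<open>The limit is a fixed point of the averaging operator; the states where it is maximal form a
  closed set on which all bets are trivial, unless the maximum is \<open>0\<close>.\<close>

lemma avg_tendsto_0:
  assumes "q \<in> states G"
  shows "(\<lambda>n. avg n q) \<longlonglongrightarrow> 0"
proof -
  have "\<exists>l. (\<lambda>n. avg n q) \<longlonglongrightarrow> l" if "q \<in> states G" for q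
    using that avg_Suc_le avg_nonneg
    by (metis decseq_SucI decseq_convergent)
  then obtain h where h: "\<And>q. q \<in> states G \<Longrightarrow> (\<lambda>n. avg n q) \<longlonglongrightarrow> h q"
    by metis
  have h_nonneg: "0 \<le> h q" if "q \<in> states G" for q
    using h[OF that] avg_nonneg[OF that] by (intro LIMSEQ_le_const) auto
  have h_idle: "h q = 0" if "q \<in> states G" "q \<in> idle" for q
    using h[OF that(1)] that(2) by (simp add: avg_idle LIMSEQ_const_iff)
  have h_eq: "h q = (\<Sum>b\<in>UNIV. \<mu> b * sqrt (bet G q b) *
     (\<Sum>q'\<in>states G. pmf (step G q b) q' * h q'))" if "q \<in> states G" for q
  proof (rule LIMSEQ_unique)
    show "(\<lambda>n. avg (Suc n) q) \<longlonglongrightarrow> h q" using h[OF that] by (rule LIMSEQ_Suc)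
    show "(\<lambda>n. avg (Suc n) q) \<longlonglongrightarrow> (\<Sum>b\<in>UNIV. \<mu> b * sqrt (bet G q b) *
       (\<Sum>q'\<in>states G. pmf (step G q b) q' * h q'))"
      unfolding avg.simps(2) by (intro tendsto_intros h)
  qed
  define g where "g = Max (h ` states G)"
  have hg: "h q \<le> g" if "q \<in> states G" for q
    unfolding g_def using finite_states that by (intro Max_ge) auto
  obtain q0 where q0: "q0 \<in> states G" "h q0 = g"
    using Max_in[of "h ` states G"] finite_states init_state unfolding g_def by fastforce
  have "g \<le> 0"
  proof (rule ccontr)
    assume "\<not> g \<le> 0"
    then have g: "0 < g" by simp
    define S where "S = {q \<in> states G. h q = g}"
    have "bet G q b = 1 \<and> set_pmf (step G q b) \<subseteq> S" if "q \<in> S" for q b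
    proof
      have q: "q \<in> states G" "h q = g" using that by (auto simp: S_def)
      let ?e = "\<lambda>b. \<Sum>q'\<in>states G. pmf (step G q b) q' * h q'"
      have e: "?e b \<le> g" for b
      proof -
        have "?e b \<le> (\<Sum>q'\<in>states G. pmf (step G q b) q' * g)"
          by (intro sum_mono mult_left_mono hg) auto
        also have "\<dots> = g" by (simp add: sum_pmf_step q flip: sum_distrib_right)
        finally show ?thesis .
      qed
      \<comment> \<open>At a maximal state the weights must sum to at least 1, the equality case of
        \<open>sum_sqrt_bet\<close>.\<close>
      have "g = (\<Sum>b\<in>UNIV. \<mu> b * sqrt (bet G q b) * ?e b)"
        using h_eq[OF q(1)] q(2) by simp
      also have "\<dots> \<le> (\<Sum>b\<in>UNIV. \<mu> b * sqrt (bet G q b) * g)"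
        by (intro sum_mono mult_left_mono weight_nonneg q e)
      finally have "g \<le> (\<Sum>b\<in>UNIV. \<mu> b * sqrt (bet G q b) * g)" .
      then have "1 \<le> (\<Sum>b\<in>UNIV. \<mu> b * sqrt (bet G q b))"
        using g by (simp flip: sum_distrib_right)
      then have bet1: "bet G q b = 1" for b by (rule sum_sqrt_bet(2)[OF q(1)])
      then show "bet G q b = 1" .
      \<comment> \<open>With trivial bets, \<open>g\<close> is a mean of values at most
        \<open>g\<close> with positive weights, so all of them equal \<open>g\<close>. The same
        argument then applies to the successors of each letter.\<close>
      have "(\<Sum>b\<in>UNIV. \<mu> b * ?e b) = g" using h_eq[OF q(1)] q(2) bet1 by simp
      then have "(\<Sum>b\<in>UNIV. \<mu> b * (g - ?e b)) = 0"
        by (simp add: right_diff_distrib sum_subtractf mu_sum flip: sum_distrib_right)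
      moreover have "0 \<le> \<mu> b * (g - ?e b)" for b using e[of b] mu_pos[of b] by simp
      ultimately have "\<mu> b * (g - ?e b) = 0" by (simp add: sum_nonneg_eq_0_iff)
      then have "?e b = g" using mu_pos[of b] by simp
      then have "(\<Sum>q'\<in>states G. pmf (step G q b) q' * (g - h q')) = 0"
        by (simp add: right_diff_distrib sum_subtractf sum_pmf_step q flip: sum_distrib_right)
      moreover have "0 \<le> pmf (step G q b) q' * (g - h q')" if "q' \<in> states G" for q'
        using hg[OF that] by simp
      ultimately have "\<forall>q'\<in>states G. pmf (step G q b) q' * (g - h q') = 0"
        using finite_states by (simp add: sum_nonneg_eq_0_iff)
      then show "set_pmf (step G q b) \<subseteq> S"
        using step_state[OF q(1)] by (fastforce simp: S_def set_pmf_iff)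
    qed
    moreover have "S \<subseteq> states G" by (auto simp: S_def)
    ultimately have "S \<subseteq> idle" unfolding idle_def by (intro Union_upper CollectI conjI ballI allI) auto
    then have "h q0 = 0" using q0 h_idle by (auto simp: S_def)
    with q0 g show False by simp
  qed
  then have "h q = 0" using hg[OF assms] h_nonneg[OF assms] by linarith
  with h[OF assms] show ?thesis by simp
qed

section \<open>Block products along a sequence\<close>

context
  fixes X :: "nat \<Rightarrow> 'a" and L :: nat
  assumes L: "0 < L"
begin

text \<open>Sliding the window by one position replaces the factor at \<open>N\<close> by the one at
  \<open>N + L\<close>, at the cost of \<open>tot\<close> of the block in between. Every position is
  thus used once, matching overlapping frequencies.\<close>

lemma prod_window_le:
  "(\<Prod>i<L. val (init G) (map X [0..<N + i]))
    \<le> (\<Prod>i<L. val (init G) (map X [0..<i])) * (\<Prod>j<N. tot (map X [j..<j + L]))"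
proof (induction N)
  case (Suc N)
  let ?f = "\<lambda>n. val (init G) (map X [0..<n])"
  obtain L' where L': "L = Suc L'" using L by (cases L) auto
  have "(\<Prod>i<L. ?f (Suc N + i)) = (\<Prod>i<L'. ?f (N + Suc i)) * ?f (N + L)"
    by (simp add: L')
  also have "?f (N + L) \<le> ?f N * tot (map X [N..<N + L])"
    using val_append[OF init_state, of "map X [0..<N]" "map X [N..<N + L]"]
    by (simp add: upt_add_eq_append[of 0 N L] flip: map_append)
  then have "(\<Prod>i<L'. ?f (N + Suc i)) * ?f (N + L)
      \<le> (\<Prod>i<L'. ?f (N + Suc i)) * (?f N * tot (map X [N..<N + L]))"
    by (intro mult_left_mono prod_nonneg val_nonneg init_state)
  also have "\<dots> = (\<Prod>i<L. ?f (N + i)) * tot (map X [N..<N + L])"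
    by (simp add: L' prod.lessThan_Suc_shift del: prod.lessThan_Suc)
  also have "\<dots> \<le> ((\<Prod>i<L. ?f i) * (\<Prod>j<N. tot (map X [j..<j + L]))) * tot (map X [N..<N + L])"
    by (intro mult_right_mono Suc tot_nonneg)
  finally show ?case by (simp add: mult.assoc)
qed simp

lemma prod_tot_le:
  "(\<Prod>j<N. tot (map X [j..<j + L])) \<le> exp ((\<Sum>j<N. tot (map X [j..<j + L])) - real N)"
proof -
  have "(\<Prod>j<N. tot (map X [j..<j + L])) \<le> (\<Prod>j<N. exp (tot (map X [j..<j + L]) - 1))"
  proof (intro prod_mono conjI tot_nonneg)
    fix j show "tot (map X [j..<j + L]) \<le> exp (tot (map X [j..<j + L]) - 1)"
      using exp_ge_add_one_self[of "tot (map X [j..<j + L]) - 1"] by simp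
  qed
  also have "\<dots> = exp ((\<Sum>j<N. tot (map X [j..<j + L])) - real N)"
    by (simp add: exp_sum[symmetric] sum_subtractf)
  finally show ?thesis .
qed

text \<open>Grouping positions by the factor read there makes the mean a finite linear combination
  of frequencies of words of length \<open>L\<close>.\<close>

lemma mean_tot_tendsto:
  assumes "normal_seq \<mu> X"
  shows "(\<lambda>N. (\<Sum>j<N. tot (map X [j..<j + L])) / real N) \<longlonglongrightarrow> (\<Sum>q\<in>states G. avg L q)"
proof -
  have "(\<Sum>j<N. tot (map X [j..<j + L])) / real N
    = (\<Sum>u | length u = L. tot u * (factor_count X u N / real N))" for N
  proof -
    have "tot (map X [j..<j + L])
      = (\<Sum>u | length u = L. tot u * of_bool (map X [j..<j + length u] = u))" for j
    proof -
      have "(\<Sum>u | length u = L. tot u * of_bool (map X [j..<j + length u] = u))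
        = (\<Sum>u | length u = L. if u = map X [j..<j + L] then tot u else 0)"
        by (intro sum.cong) auto
      then show ?thesis by simp
    qed
    then have "(\<Sum>j<N. tot (map X [j..<j + L]))
      = (\<Sum>u | length u = L. tot u * factor_count X u N)"
      unfolding factor_count_def sum_distrib_left by (subst sum.swap) simp
    then show ?thesis by (simp add: sum_divide_distrib)
  qed
  moreover have "(\<lambda>N. \<Sum>u | length u = L. tot u * (factor_count X u N / real N))
    \<longlonglongrightarrow> (\<Sum>u | length u = L. tot u * word_measure \<mu> u)"
    using assms unfolding normal_seq_iff by (intro tendsto_intros) auto
  moreover have "(\<Sum>u | length u = L. tot u * word_measure \<mu> u) = (\<Sum>q\<in>states G. avg L q)"
    unfolding avg_eq tot_def sum_distrib_right
    by (subst sum.swap) (simp add: mult.commute)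
  ultimately show ?thesis by simp
qed

end

text \<open>The window product decays exponentially. Its factors are comparable up to a constant, so
  an \<open>L\<close>-th root gives geometric decay of each of them.\<close>

lemma summable_val:
  assumes "normal_seq \<mu> X"
  shows "summable (\<lambda>n. val (init G) (map X [0..<n]))"
proof -
  let ?f = "\<lambda>n. val (init G) (map X [0..<n])"
  have "(\<lambda>n. \<Sum>q\<in>states G. avg n q) \<longlonglongrightarrow> (\<Sum>q\<in>states G. 0)"
    by (intro tendsto_sum avg_tendsto_0)
  then have "\<forall>\<^sub>F n in sequentially. (\<Sum>q\<in>states G. avg n q) < 1"
    by (auto dest: order_tendstoD(2)[where a = 1])
  then have "\<forall>\<^sub>F n in sequentially. 0 < n \<and> (\<Sum>q\<in>states G. avg n q) < 1"
    using eventually_gt_at_top[of 0] by eventually_elim simp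
  then obtain L where L: "0 < L" "(\<Sum>q\<in>states G. avg L q) < 1"
    using eventually_happens'[OF sequentially_bot] by blast
  then obtain c where c: "(\<Sum>q\<in>states G. avg L q) < c" "c < 1" using dense by blast
  \<comment> \<open>A bound on the growth per letter, used to compare \<open>?f (N + L)\<close> with
    the earlier members of its window.\<close>
  define B where "B = 1 + (\<Sum>b\<in>UNIV. tot [b])"
  have B: "1 \<le> B" "tot [b] \<le> B" for b
    using tot_nonneg member_le_sum[of b UNIV "\<lambda>b. tot [b]"]
    by (auto simp: B_def intro: sum_nonneg)
  have f_nonneg: "0 \<le> ?f n" for n by (intro val_nonneg init_state)
  have f_step: "?f (n + k) \<le> ?f n * B ^ k" for n k
  proof (induction k)
    case (Suc k)
    have "?f (n + Suc k) \<le> ?f (n + k) * tot [X (n + k)]"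
      using val_append[OF init_state, of "map X [0..<n + k]" "[X (n + k)]"] by simp
    also have "\<dots> \<le> (?f n * B ^ k) * B"
      using B Suc f_nonneg tot_nonneg by (intro mult_mono) auto
    finally show ?case by (simp add: mult_ac)
  qed simp
  \<comment> \<open>The maximum with 1 ensures \<open>K \<le> K ^ L\<close>, so that the whole bound
    becomes an \<open>L\<close>-th power; \<open>r\<close> is the \<open>L\<close>-th root of the
    decay rate.\<close>
  define K where "K = max 1 ((B ^ L) ^ L * (\<Prod>i<L. ?f i))"
  define r where "r = exp (- (1 - c) / real L)"
  have bound: "\<forall>\<^sub>F N in sequentially. ?f (N + L) \<le> K * r ^ N"
  proof -
    have "\<forall>\<^sub>F N in sequentially. (\<Sum>j<N. tot (map X [j..<j + L])) / real N < c"
      using mean_tot_tendsto[OF L(1) assms] c(1) by (rule order_tendstoD(2))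
    then show ?thesis
      using eventually_gt_at_top[of 0]
    proof eventually_elim
      case (elim N)
      have "?f (N + L) ^ L = (\<Prod>i<L. ?f (N + L))" by simp
      also have "\<dots> \<le> (\<Prod>i<L. ?f (N + i) * B ^ L)"
      proof (intro prod_mono conjI f_nonneg)
        fix i assume "i \<in> {..<L}"
        then have "?f (N + L) \<le> ?f (N + i) * B ^ (L - i)"
          using f_step[of "N + i" "L - i"] by simp
        also have "\<dots> \<le> ?f (N + i) * B ^ L"
          using B f_nonneg by (intro mult_left_mono power_increasing) auto
        finally show "?f (N + L) \<le> ?f (N + i) * B ^ L" .
      qed
      also have "\<dots> = (B ^ L) ^ L * (\<Prod>i<L. ?f (N + i))" by (simp add: prod.distrib)
      also have "\<dots> \<le> (B ^ L) ^ L * ((\<Prod>i<L. ?f i) * (\<Prod>j<N. tot (map X [j..<j + L])))"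
        using prod_window_le[OF L(1), of X N] B by (intro mult_left_mono) auto
      also have "\<dots> = ((B ^ L) ^ L * (\<Prod>i<L. ?f i)) * (\<Prod>j<N. tot (map X [j..<j + L]))"
        by (simp add: mult.assoc)
      also have "\<dots> \<le> K * exp (- (1 - c) * real N)"
      proof (intro mult_mono)
        have "(\<Prod>j<N. tot (map X [j..<j + L])) \<le> exp ((\<Sum>j<N. tot (map X [j..<j + L])) - real N)"
          by (rule prod_tot_le[OF L(1)])
        also have "\<dots> \<le> exp (- (1 - c) * real N)"
          using elim by (simp add: field_simps)
        finally show "(\<Prod>j<N. tot (map X [j..<j + L])) \<le> exp (- (1 - c) * real N)" .
      qed (auto simp: K_def intro: prod_nonneg tot_nonneg)
      also have "\<dots> \<le> K ^ L * exp (- (1 - c) * real N)"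
        using L(1) self_le_power[of K L] by (intro mult_right_mono) (auto simp: K_def)
      also have "\<dots> = (K * r ^ N) ^ L"
      proof -
        have "(r ^ N) ^ L = exp (real (N * L) * (- (1 - c) / real L))"
          by (simp only: r_def exp_of_nat_mult power_mult)
        also have "real (N * L) * (- (1 - c) / real L) = - (1 - c) * real N"
          using L(1) by simp
        finally show ?thesis by (simp add: power_mult_distrib)
      qed
      finally have "?f (N + L) ^ L \<le> (K * r ^ N) ^ L" .
      moreover have "0 \<le> K * r ^ N" by (simp add: K_def r_def)
      ultimately show "?f (N + L) \<le> K * r ^ N"
        using power_mono_iff[OF f_nonneg _ L(1)] by blast
    qed
  qed
  have "norm r < 1" using c L by (simp add: r_def divide_neg_pos)
  then have "summable (\<lambda>N. K * r ^ N)" by (intro summable_mult summable_geometric)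
  then have "summable (\<lambda>N. ?f (N + L))"
    by (rule summable_comparison_test_ev[rotated])
      (use bound in \<open>simp add: f_nonneg\<close>)
  then show ?thesis using summable_iff_shift[of ?f L] by blast
qed

subsection \<open>Tail estimate for the random run\<close>

text \<open>\<open>rich X k t q c \<omega>\<close>: started at time \<open>t\<close> in state \<open>q\<close> with a capital whose
  square root is \<open>c\<close>, after \<open>k\<close> bets the gambler is in a non-idle state with capital at least \<open>1\<close>.\<close>

primrec rich :: "(nat \<Rightarrow> 'a) \<Rightarrow> nat \<Rightarrow> nat \<Rightarrow> 's \<Rightarrow> real \<Rightarrow> (nat \<times> 's \<times> 'a \<Rightarrow> 's) \<Rightarrow> bool" where
  "rich X 0 t q c \<omega> \<longleftrightarrow> q \<notin> idle \<and> 1 \<le> c"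
| "rich X (Suc k) t q c \<omega> \<longleftrightarrow>
     (\<exists>q'\<in>states G. \<omega> (Suc t, q, X t) = q' \<and> rich X k (Suc t) q' (c * sqrt (bet G q (X t))) \<omega>)"

text \<open>Conditioning on the past: \<open>J\<close> lists the choices already inspected.\<close>

definition cylinder :: "(nat \<times> 's \<times> 'a) set \<Rightarrow> (nat \<times> 's \<times> 'a \<Rightarrow> 's) \<Rightarrow> (nat \<times> 's \<times> 'a \<Rightarrow> 's) set" where
  "cylinder J z = {\<omega> \<in> space (choice_space G). \<forall>j\<in>J. \<omega> j = z j}"

lemma
  assumes "finite J" "J \<subseteq> UNIV \<times> states G \<times> UNIV"
  shows sets_cylinder: "cylinder J z \<in> sets (choice_space G)"
    and emeasure_cylinder: "emeasure (choice_space G) (cylinder J z)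
      = (\<Prod>j\<in>J. ennreal (pmf (step G (fst (snd j)) (snd (snd j))) (z j)))"
proof -
  let ?I = "UNIV \<times> states G \<times> (UNIV :: 'a set)"
  let ?M = "\<lambda>j :: nat \<times> 's \<times> 'a. measure_pmf (step G (fst (snd j)) (snd (snd j)))"
  interpret product_prob_space ?M ?I
    by (rule product_prob_spaceI) (rule prob_space_measure_pmf)
  have cs: "choice_space G = PiM ?I ?M"
    by (simp add: choice_space_def case_prod_unfold)
  have cyl: "cylinder J z = {\<omega> \<in> space (PiM ?I ?M). \<forall>j\<in>J. \<omega> j \<in> {z j}}"
    by (simp add: cylinder_def cs)
  show "cylinder J z \<in> sets (choice_space G)"
    unfolding cyl cs using assms
    by (intro sets.sets_Collect_finite_All sets_Collect_single) auto
  show "emeasure (choice_space G) (cylinder J z)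
      = (\<Prod>j\<in>J. ennreal (pmf (step G (fst (snd j)) (snd (snd j))) (z j)))"
    unfolding cyl unfolding cs
    using emeasure_PiM_Collect[OF assms(2,1), of "\<lambda>j. {z j}"] by (simp add: emeasure_pmf_single)
qed

text \<open>The next choice has time \<open>Suc t\<close> and so is not in \<open>J\<close>; by
  independence, fixing its value multiplies the measure by its probability. Quantifying over
  \<open>J\<close> and \<open>z\<close> lets the induction refine the cylinder.\<close>

lemma rich_bound:
  assumes "finite J" "J \<subseteq> {..t} \<times> states G \<times> UNIV" "q \<in> states G" "0 \<le> c"
  shows "{\<omega> \<in> cylinder J z. rich X k t q c \<omega>} \<in> sets (choice_space G) \<and>
    emeasure (choice_space G) {\<omega> \<in> cylinder J z. rich X k t q c \<omega>}
      \<le> emeasure (choice_space G) (cylinder J z) * ennreal (c * val q (map X [t..<t + k]))"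
  using assms
proof (induction k arbitrary: t q c J z)
  case 0
  then have "cylinder J z \<in> sets (choice_space G)" by (intro sets_cylinder) auto
  then show ?case
    \<comment> \<open>Markov's inequality: the indicator of \<open>1 \<le> c\<close> is at most
      \<open>c\<close>.\<close>
    using mult_left_mono[of 1 "ennreal c" "emeasure (choice_space G) (cylinder J z)"]
    by (cases "q \<notin> idle \<and> 1 \<le> c") auto
next
  case (Suc k)
  let ?M = "choice_space G" and ?j = "(Suc t, q, X t)" and ?c = "c * sqrt (bet G q (X t))"
  have j: "?j \<notin> J" using Suc.prems by auto
  let ?Z = "\<lambda>q'. cylinder (insert ?j J) (z(?j := q'))"
  let ?R = "\<lambda>q'. {\<omega> \<in> ?Z q'. rich X k (Suc t) q' ?c \<omega>}"
  have eq: "{\<omega> \<in> cylinder J z. rich X (Suc k) t q c \<omega>} = (\<Union>q'\<in>states G. ?R q')"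
    using j by (auto simp: cylinder_def)
  have c: "0 \<le> ?c" using Suc.prems bet_nonneg by simp
  have IH: "?R q' \<in> sets ?M \<and>
      emeasure ?M (?R q') \<le> emeasure ?M (?Z q') * ennreal (?c * val q' (map X [Suc t..<Suc t + k]))"
    if "q' \<in> states G" for q'
    using Suc.prems that c by (intro Suc.IH) auto
  have Z: "emeasure ?M (?Z q') = emeasure ?M (cylinder J z) * ennreal (pmf (step G q (X t)) q')" for q'
  proof -
    have "(\<Prod>i\<in>J. ennreal (pmf (step G (fst (snd i)) (snd (snd i))) ((z(?j := q')) i)))
      = (\<Prod>i\<in>J. ennreal (pmf (step G (fst (snd i)) (snd (snd i))) (z i)))"
      using j by (intro prod.cong) auto
    then show ?thesis
      using Suc.prems j by (subst (1 2) emeasure_cylinder) (auto simp: mult.commute)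
  qed
  have "emeasure ?M (\<Union>q'\<in>states G. ?R q') \<le> (\<Sum>q'\<in>states G. emeasure ?M (?R q'))"
    using IH finite_states by (intro emeasure_subadditive_finite) auto
  also have "\<dots> \<le> (\<Sum>q'\<in>states G. emeasure ?M (cylinder J z) *
      ennreal (pmf (step G q (X t)) q' * (?c * val q' (map X [Suc t..<Suc t + k]))))"
  proof (intro sum_mono)
    fix q' assume q': "q' \<in> states G"
    then have "0 \<le> ?c * val q' (map X [Suc t..<Suc t + k])" using c val_nonneg by simp
    with IH[OF q'] show "emeasure ?M (?R q') \<le> emeasure ?M (cylinder J z) *
      ennreal (pmf (step G q (X t)) q' * (?c * val q' (map X [Suc t..<Suc t + k])))"
      by (simp add: Z ennreal_mult mult.assoc)
  qed
  also have "\<dots> = emeasure ?M (cylinder J z) * ennreal (\<Sum>q'\<in>states G.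
      pmf (step G q (X t)) q' * (?c * val q' (map X [Suc t..<Suc t + k])))"
    using c val_nonneg by (simp flip: sum_distrib_left)
  also have "(\<Sum>q'\<in>states G. pmf (step G q (X t)) q' * (?c * val q' (map X [Suc t..<Suc t + k])))
    = c * val q (map X [t..<t + Suc k])"
    by (simp add: upt_conv_Cons sum_distrib_left mult_ac del: upt_Suc)
  finally show ?case
    unfolding eq using IH finite_states by (intro conjI sets.finite_UN) blast+
qed

text \<open>Translates the recursive event back to the actual run; \<open>c\<close> accumulates the
  square roots of the bets already made.\<close>

lemma rich_run:
  assumes "\<And>i. run G X \<omega> i \<in> states G"
    and "run G X \<omega> (t + k) \<notin> idle"
    and "1 \<le> c * sqrt (\<Prod>i<k. bet G (run G X \<omega> (t + i)) (X (t + i)))"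
  shows "rich X k t (run G X \<omega> t) c \<omega>"
  using assms(2,3)
proof (induction k arbitrary: t c)
  case (Suc k)
  have "rich X k (Suc t) (run G X \<omega> (Suc t)) (c * sqrt (bet G (run G X \<omega> t) (X t))) \<omega>"
    using Suc.prems
    by (intro Suc.IH) (simp_all add: prod.lessThan_Suc_shift real_sqrt_mult mult.assoc del: prod.lessThan_Suc)
  then show ?case using assms(1)[of "Suc t"] by simp
qed simp

lemma loses_normal:
  assumes "normal_seq \<mu> X"
  shows "AE \<omega> in choice_space G. loses G X \<omega>"
proof -
  let ?M = "choice_space G"
  interpret prob_space ?M by (rule prob_space_choice_space)
  define A where "A n = {\<omega> \<in> space ?M. rich X n 0 (init G) 1 \<omega>}" for n
  have cyl: "cylinder {} z = space ?M" for z by (simp add: cylinder_def)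
  have A: "A n \<in> sets ?M" "emeasure ?M (A n) \<le> ennreal (val (init G) (map X [0..<n]))" for n
    \<comment> \<open>Nothing has been inspected yet: the empty cylinder is the whole space,
      whatever \<open>z\<close> is.\<close>
    using rich_bound[of "{}" 0 "init G" 1 undefined X n] init_state
    by (auto simp: cyl A_def emeasure_space_1)
  then have "measure ?M (A n) \<le> val (init G) (map X [0..<n])" for n
    using val_nonneg[OF init_state] by (simp add: emeasure_eq_measure)
  then have "summable (\<lambda>n. measure ?M (A n))"
    using summable_val[OF assms]
    by (intro summable_comparison_test[of "\<lambda>n. measure ?M (A n)"]) auto
  then have "AE \<omega> in ?M. \<forall>\<^sub>F n in sequentially. \<omega> \<in> space ?M - A n"
    using A(1) by (intro borel_cantelli_AE1) (auto simp: less_top[symmetric])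
  then show ?thesis
    using AE_choices_supported[OF finite_states]
  proof eventually_elim
    case (elim \<omega>)
    have st: "run G X \<omega> n \<in> states G" for n
    proof (induction n)
      case (Suc n)
      with elim(2) have "run G X \<omega> (Suc n) \<in> set_pmf (step G (run G X \<omega> n) (X n))" by simp
      with step_state[OF Suc] show ?case by blast
    qed (simp add: init_state)
    have "\<exists>C. \<forall>\<^sub>F n in sequentially. capital G X \<omega> n \<le> C"
    proof (cases "\<exists>n. run G X \<omega> n \<in> idle")
      case True
      then obtain N where N: "run G X \<omega> N \<in> idle" by blast
      have idle: "run G X \<omega> (N + n) \<in> idle" for n
      proof (induction n)
        case (Suc n)
        from elim(2) st[of "N + n"]
        have "run G X \<omega> (N + Suc n) \<in> set_pmf (step G (run G X \<omega> (N + n)) (X (N + n)))" by simp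
        with idle_step[OF Suc] show ?case by blast
      qed (simp add: N)
      have "capital G X \<omega> (N + n) = capital G X \<omega> N" for n
        using idle_bet[OF idle[of "Suc _"]] by (induction n) (simp_all add: capital_def)
      then have "capital G X \<omega> n \<le> capital G X \<omega> N" if "n \<ge> N" for n
        using that by (metis le_add_diff_inverse order_refl)
      then show ?thesis by (auto simp: eventually_sequentially)
    next
      case False
      \<comment> \<open>The index is shifted because \<open>capital G X \<omega> n\<close> includes
        \<open>n + 1\<close> bets.\<close>
      have "\<forall>\<^sub>F n in sequentially. \<omega> \<in> space ?M - A (Suc n)"
        using sequentially_offset[OF elim(1), of 1] by simp
      then have "\<forall>\<^sub>F n in sequentially. capital G X \<omega> n \<le> 1"
      proof eventually_elim
        case (elim n)
        then have "\<not> rich X (Suc n) 0 (run G X \<omega> 0) 1 \<omega>" by (simp add: A_def)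
        then have "\<not> 1 \<le> 1 * sqrt (\<Prod>i<Suc n. bet G (run G X \<omega> (0 + i)) (X (0 + i)))"
          using rich_run[OF st, where t = 0 and k = "Suc n"] False by blast
        then show ?case by (simp add: capital_def lessThan_Suc_atMost del: prod.lessThan_Suc)
      qed
      then show ?thesis by blast
    qed
    then obtain C where "\<forall>\<^sub>F n in sequentially. ereal (capital G X \<omega> n) \<le> ereal C" by auto
    then have "limsup (\<lambda>n. ereal (capital G X \<omega> n)) \<le> ereal C" by (rule Limsup_bounded)
    then show ?case by (auto simp: wins_def)
  qed
qed

end

theorem theorem4p1:
  fixes \<mu> :: "'a::finite \<Rightarrow> real" and X :: "nat \<Rightarrow> 'a"
  assumes "positive_bernoulli \<mu>"
  shows "normal_seq \<mu> X \<longleftrightarrow>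
    (\<forall>G :: ('s::infinite, 'a) gambler. prob_gambler \<mu> G \<longrightarrow>
       (AE \<omega> in choice_space G. loses G X \<omega>))"
  using losing_gambler.loses_normal[OF losing_gambler.intro[OF assms]]
    normal_seq_if_gamblers_lose[OF assms] by blast

end
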